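(* Let $n\ge 2$ and $j\in\{1,\dots,n-1\}$. Let $\mathcal{D}_n$ be the set of derangements of $[n]=\{1,\dots,n\}$, and put $$\mathcal{D}_{n,j}=\{\sigma\in\mathcal{D}_n:\sigma(n)=j\},\qquad \widetilde{\mathcal{D}}_{n,j}=\{\sigma\in\mathcal{D}_n:\sigma(n+1-j)=1\}.$$ Then, with commuting indeterminates $x_1,\dots,x_n,y_1,\dots,y_n$, $$\sum_{\sigma\in\mathcal{D}_{n,j}}(-1)^{\mathrm{cyc}(\sigma)}\Bigl(\prod_{i\in\mathrm{RLMv}(\sigma)}x_i\Bigr)\Bigl(\prod_{i\in\mathrm{EXCv}(\sigma)}y_i\Bigr)=-x_1\cdots x_j\,y_{j+1}\cdots y_n,$$ and $$\sum_{\sigma\in\widetilde{\mathcal{D}}_{n,j}}(-1)^{\mathrm{cyc}(\sigma)}\Bigl(\prod_{i\in\mathrm{RLMi}(\sigma)}x_i\Bigr)\Bigl(\prod_{i\in\mathrm{EXCi}(\sigma)}y_i\Bigr)=-y_1\cdots y_{n-j}\,x_{n+1-j}\cdots x_n.$$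
   Context: A derangement of $[n]$ is a permutation $\sigma$ with $\sigma(i)\neq i$ for all $i$. For a permutation $\sigma$ of $[n]$: $\mathrm{cyc}(\sigma)$ is its number of cycles; an index $i$ is an excedance index and $\sigma(i)$ an excedance value if $\sigma(i)>i$; an index $i$ is a right-to-left minimum index and $\sigma(i)$ a right-to-left minimum value if $\sigma(i)<\sigma(k)$ for all $k>i$. $\mathrm{EXCi}(\sigma)$, $\mathrm{EXCv}(\sigma)$, $\mathrm{RLMi}(\sigma)$, $\mathrm{RLMv}(\sigma)$ denote the sets of excedance indices, excedance values, right-to-left minimum indices and right-to-left minimum values, respectively. *)

theory Defs
  imports "HOL-Combinatorics.Permutations" "HOL-Combinatorics.Orbits" "HOL-Library.Poly_Mapping"
begin

definition derangements :: "nat \<Rightarrow> (nat \<Rightarrow> nat) set" where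
  "derangements n = {\<sigma>. \<sigma> permutes {1..n} \<and> (\<forall>i\<in>{1..n}. \<sigma> i \<noteq> i)}"

definition derangements_last :: "nat \<Rightarrow> nat \<Rightarrow> (nat \<Rightarrow> nat) set" where
  "derangements_last n j = {\<sigma> \<in> derangements n. \<sigma> n = j}"

(* For 1 \<le> j \<le> n the natural-number subtraction n + 1 - j does not truncate. *)
definition derangements_one :: "nat \<Rightarrow> nat \<Rightarrow> (nat \<Rightarrow> nat) set" where
  "derangements_one n j = {\<sigma> \<in> derangements n. \<sigma> (n + 1 - j) = 1}"

(* Cycles are identified with their supports, the orbits of \<sigma> on {1..n};
   fixed points, if any, count as cycles. *)
definition cyc :: "nat \<Rightarrow> (nat \<Rightarrow> nat) \<Rightarrow> nat" where
  "cyc n \<sigma> = card (orbit \<sigma> ` {1..n})"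

definition EXCi :: "nat \<Rightarrow> (nat \<Rightarrow> nat) \<Rightarrow> nat set" where
  "EXCi n \<sigma> = {i \<in> {1..n}. \<sigma> i > i}"

definition EXCv :: "nat \<Rightarrow> (nat \<Rightarrow> nat) \<Rightarrow> nat set" where
  "EXCv n \<sigma> = \<sigma> ` EXCi n \<sigma>"

definition RLMi :: "nat \<Rightarrow> (nat \<Rightarrow> nat) \<Rightarrow> nat set" where
  "RLMi n \<sigma> = {i \<in> {1..n}. \<forall>k\<in>{1..n}. k > i \<longrightarrow> \<sigma> i < \<sigma> k}"

definition RLMv :: "nat \<Rightarrow> (nat \<Rightarrow> nat) \<Rightarrow> nat set" where
  "RLMv n \<sigma> = \<sigma> ` RLMi n \<sigma>"

(* Polynomials with integer coefficients in the indeterminates x_i, y_i (i a natural number):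
   a monomial is a finitely supported exponent vector, and a polynomial is a finitely supported
   map from monomials to coefficients, multiplied by convolution. *)
datatype indet = X nat | Y nat

type_synonym xy_poly = "(indet \<Rightarrow>\<^sub>0 nat) \<Rightarrow>\<^sub>0 int"

definition indet_poly :: "indet \<Rightarrow> xy_poly" where
  "indet_poly v = Poly_Mapping.single (Poly_Mapping.single v 1) 1"

abbreviation x_var :: "nat \<Rightarrow> xy_poly" where
  "x_var i \<equiv> indet_poly (X i)"

abbreviation y_var :: "nat \<Rightarrow> xy_poly" where
  "y_var i \<equiv> indet_poly (Y i)"

end

theory Submission
  imports Defs
begin

text \<open>
  Write $p = \sigma^{-1}$: right-to-left minimum values of $\sigma$ become left-to-right maximum
  indices of $p$, excedance values become indices with $p(v) < v$, and $\sigma(n) = j$ becomes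
  $p(j) = n$. Up to the factor $(-1)^n$, the sign $(-1)^{cyc}$ is the sign of the permutation.
  The signed sum of an arbitrary function of the two index sets is computed for the derangements of
  $\{m,\dots,n\}$, by descending induction on $m$. If neither $p(m+1) = m$ nor $p(m) = m+1$, exchanging the
  values $m$ and $m+1$ reverses the sign and keeps both sets. If only $p(m) = m+1$, the same exchange
  fixes $m$ and leaves a derangement of $\{m+1,\dots,n\}$. If $p(m+1) = m$, exchanging the
  positions $m$ and $m+1$ leaves a derangement of $\{m+1,\dots,n\}$ or of $\{m+2,\dots,n\}$, and
  for $j > m$ the contributions of these two kinds cancel. The second identity follows from the
  first by the symmetry $i \mapsto n+1-i$.
\<close>

section \<open>Parity of the number of cycles\<close>

text \<open>The composed permutation fixes \<open>a\<close> and sends the predecessor of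
  \<open>a\<close> straight to \<open>p a\<close>. It thus cuts \<open>a\<close> out of its cycle
  and changes nothing else.\<close>

lemma orbit_transpose_comp:
  assumes p: "permutation p" and pa: "p a \<noteq> a" and xa: "x \<noteq> a"
  shows "orbit (transpose a (p a) \<circ> p) x = orbit p x - {a}"
proof -
  define q where "q = transpose a (p a) \<circ> p"
  have inj: "p y = p z \<longleftrightarrow> y = z" for y z
    using permutation_bijective[OF p] by (meson bij_def injD)
  have q: "q y = (if p y = a then p a else p y)" if "y \<noteq> a" for y
    using that pa by (auto simp: q_def transpose_def inj)
  have "y \<in> orbit p x - {a}" if "y \<in> orbit q x" for y
    using that
  proof induction
    case base
    show ?case
      using q[OF xa] pa orbit.base[of p x] orbit.step[of "p x" p x] by auto
  next
    case (step y)
    then have y: "y \<noteq> a" "p y \<in> orbit p x"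
      using orbit.step[of y p x] by auto
    then show ?case
      using q[OF y(1)] pa orbit.step[of "p y" p x] by auto
  qed
  \<comment> \<open>When the walk along \<open>p\<close> reaches \<open>a\<close>, which
    \<open>q\<close> skips, the induction carries \<open>p a\<close> in its place; this is exactly
    what the next step needs.\<close>
  moreover have "if y = a then p a \<in> orbit q x else y \<in> orbit q x" if "y \<in> orbit p x" for y
    using that
  proof induction
    case base
    show ?case
      using q[OF xa] orbit.base[of q x] by auto
  next
    case (step y)
    then show ?case
      using q[of y] orbit.step[of y q x] pa by (auto split: if_splits)
  qed
  ultimately have "y \<in> orbit q x \<longleftrightarrow> y \<in> orbit p x - {a}" for y
    by (metis Diff_iff singletonI)
  then show ?thesis
    unfolding q_def by blast
qed

text \<open>Induction on the set, by removing a point \<open>a\<close>. If \<open>a\<close> is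
  fixed, one element and one orbit disappear and the sign stays. Otherwise cutting \<open>a\<close>
  out of its cycle keeps the number of orbits, while the size of the set drops by one and the sign
  flips.\<close>

lemma card_orbits_parity:
  assumes "finite S" "p permutes S"
  shows "(- 1) ^ card (orbit p ` S) = (- 1) ^ card S * sign p"
  using assms
proof (induction S arbitrary: p rule: finite_induct)
  case empty
  then show ?case by simp
next
  case (insert a S)
  have p: "permutation p"
    using insert.prems insert.hyps(1) permutation_permutes by blast
  show ?case
  proof (cases "p a = a")
    case True
    then have "p permutes S"
      using insert.prems by (intro permutes_superset[OF insert.prems]) auto
    moreover have "orbit p a \<notin> orbit p ` S"
    proof
      assume "orbit p a \<in> orbit p ` S"
      then obtain x where "x \<in> S" "orbit p a = orbit p x"
        by auto
      moreover have "orbit p a = {a}"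
        using True by (simp add: orbit_eq_singleton_iff)
      moreover have "x \<in> orbit p x"
        by (rule permutation_self_in_orbit[OF p])
      ultimately show False
        using insert.hyps(2) by auto
    qed
    ultimately show ?thesis
      using insert by simp
  next
    case False
    define q where "q = transpose a (p a) \<circ> p"
    have q: "q permutes S"
      unfolding q_def by (rule permutes_insert_lemma[OF insert.prems])
    have paS: "p a \<in> S"
      using False insert.prems by (metis insertE insertI1 permutes_in_image)
    have self: "x \<in> orbit p x" for x
      by (rule permutation_self_in_orbit[OF p])
    have eq: "orbit p x = orbit p y" if "x \<in> orbit p y" for x y
      using orbit_cyclic_eq3 cyclic_on_orbit[OF insert.prems] insert.hyps(1) that
      by (metis finite_insert)
    have "orbit p a = orbit p (p a)"
      by (rule eq[symmetric]) (rule orbit.base)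
    then have orbits_p: "orbit p ` insert a S = orbit p ` S"
      using paS by auto
    have orbits_q: "orbit q ` S = (\<lambda>T. T - {a}) ` orbit p ` S"
      unfolding image_image
    proof (rule image_cong[OF refl])
      fix x assume "x \<in> S"
      then show "orbit q x = orbit p x - {a}"
        unfolding q_def using insert.hyps(2) by (intro orbit_transpose_comp p False) auto
    qed
    \<comment> \<open>The orbit of a point \<open>x\<close> of \<open>S\<close> still contains
      \<open>x\<close> after \<open>a\<close> is deleted, so distinct orbits stay distinct.\<close>
    have "inj_on (\<lambda>T. T - {a}) (orbit p ` S)"
    proof (rule inj_onI, elim imageE)
      fix T U x y
      assume *: "T - {a} = U - {a}" "T = orbit p x" "U = orbit p y" "x \<in> S" "y \<in> S"
      then have "x \<in> orbit p y"
        using self[of x] insert.hyps(2) by blast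
      then show "T = U"
        using * eq by blast
    qed
    then have "card (orbit q ` S) = card (orbit p ` insert a S)"
      unfolding orbits_p orbits_q by (rule card_image)
    moreover have "sign q = - sign p"
      unfolding q_def using False p
      by (subst sign_compose) (auto simp: sign_swap_id permutation_swap_id)
    ultimately show ?thesis
      using insert.IH[OF q] insert.hyps by simp
  qed
qed

section \<open>Effect of adjacent exchanges on left-to-right maxima and anti-excedances\<close>

definition lr_max :: "nat \<Rightarrow> (nat \<Rightarrow> nat) \<Rightarrow> nat set" where
  "lr_max n p = {v \<in> {1..n}. \<forall>w\<in>{1..<v}. p w < p v}"

definition anti_exc :: "nat \<Rightarrow> (nat \<Rightarrow> nat) \<Rightarrow> nat set" where
  "anti_exc n p = {v \<in> {1..n}. p v < v}"

text \<open>Comparisons with a value other than \<open>m\<close> and \<open>m + 1\<close> are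
  unaffected, so only positions holding one of these two matter. Such a position is either
  \<open>m\<close>, where all earlier values are fixed points below \<open>m\<close>, or at least
  \<open>m + 2\<close>. In the latter case the larger value at position \<open>m + 1\<close> rules
  out a maximum before and after the exchange, and both values lie below the position.\<close>

lemma transpose_values_lr_max_anti_exc:
  fixes m n :: nat
  assumes p: "p permutes {m..n}" and m: "1 \<le> m" "p m \<noteq> m" "m + 2 \<le> p (m + 1)"
  shows "lr_max n (transpose m (m + 1) \<circ> p) = lr_max n p"
    and "anti_exc n (transpose m (m + 1) \<circ> p) = anti_exc n p"
proof -
  define t where "t = transpose m (m + 1)"
  have below: "p i = i" if "i < m" for i
    using p that by (auto simp: permutes_def)
  have above: "m \<le> p i" if "m \<le> i" for i
    using p that permutes_in_image[OF p, of i] permutes_not_in[OF p, of i]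
    by (cases "i \<in> {m..n}") auto
  have t1: "t m = m + 1" "t (m + 1) = m" "t (Suc m) = m"
    by (auto simp: t_def)
  have t2: "t x = x" if "x \<noteq> m" "x \<noteq> m + 1" for x
    using that by (simp add: t_def transpose_def)
  have t3: "t x < y \<longleftrightarrow> x < y" if "y \<noteq> m" "y \<noteq> m + 1" for x y
    using that by (auto simp: t_def transpose_def)
  have pre: "v \<ge> m + 2 \<or> v = m \<and> p v = m + 1" if "p v = m \<or> p v = m + 1" for v
    using that m below[of v] by (cases "v < m"; cases "v = m"; cases "v = m + 1") auto
  have "(\<forall>w\<in>{1..<v}. t (p w) < t (p v)) \<longleftrightarrow> (\<forall>w\<in>{1..<v}. p w < p v)" (is "?l \<longleftrightarrow> ?r") for v
  proof (cases "p v = m \<or> p v = m + 1")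
    case False
    then show ?thesis by (simp add: t2 t3)
  next
    case True
    from pre[OF this] show ?thesis
    proof
      assume v: "v \<ge> m + 2"
      then have w: "m + 1 \<in> {1..<v}"
        by simp
      have "t (p (m + 1)) = p (m + 1)" "t (p v) < m + 2" "p v < m + 2"
        using t2 m(3) True t1 by auto
      then have "\<not> t (p (m + 1)) < t (p v)" "\<not> p (m + 1) < p v"
        using m(3) by linarith+
      then show ?thesis
        using w by blast
    next
      assume "v = m \<and> p v = m + 1"
      then show ?thesis
        using below t1 t2 by auto
    qed
  qed
  then show "lr_max n (t \<circ> p) = lr_max n p"
    by (simp add: lr_max_def)
  have "t (p v) < v \<longleftrightarrow> p v < v" for v
  proof (cases "p v = m \<or> p v = m + 1")
    case False
    then show ?thesis by (simp add: t2)
  next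
    case True
    then show ?thesis using pre[of v] t1 by auto
  qed
  then show "anti_exc n (t \<circ> p) = anti_exc n p"
    by (simp add: anti_exc_def)
qed

text \<open>After the exchange \<open>m\<close> is fixed and position \<open>m + 1\<close> holds
  \<open>p m > m\<close>, so it is a left-to-right maximum and no anti-excedance. In
  \<open>p\<close> it holds \<open>m\<close>, and both properties are reversed. All other positions
  keep their status.\<close>

lemma transpose_positions_lr_max_anti_exc:
  fixes m n :: nat
  assumes p: "p permutes {m..n}" and m: "1 \<le> m" "m < n" "p (m + 1) = m"
  shows "lr_max n p = lr_max n (p \<circ> transpose m (m + 1)) - {m + 1}"
    and "anti_exc n p = insert (m + 1) (anti_exc n (p \<circ> transpose m (m + 1)))"
proof -
  define q where "q = p \<circ> transpose m (m + 1)"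
  have below: "p i = i" if "i < m" for i
    using p that by (auto simp: permutes_def)
  have pm: "m < p m"
  proof -
    have "p m \<in> {m..n}"
      using permutes_in_image[OF p, of m] m by simp
    moreover have "p m \<noteq> p (m + 1)"
      using inj_eq[OF permutes_inj[OF p]] by simp
    ultimately show ?thesis
      using m by auto
  qed
  have qm: "q m = m" "q (m + 1) = p m"
    using m by (auto simp: q_def)
  have q: "q i = p i" if "i \<noteq> m" "i \<noteq> m + 1" for i
    using that by (simp add: q_def transpose_def)
  \<comment> \<open>Both exchanged positions precede \<open>v\<close>, so the set of earlier values
    is the same, and being a maximum depends on that set only.\<close>
  have img: "q ` {1..<v} = p ` {1..<v}" if "m + 2 \<le> v" for v
  proof -
    have "transpose m (m + 1) permutes {1..<v}"
      using m that by (intro permutes_swap_id) auto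
    then show ?thesis
      unfolding q_def image_comp[symmetric] by (simp add: permutes_image)
  qed
  have lr: "(\<forall>w\<in>{1..<v}. f w < f v) \<longleftrightarrow> (\<forall>u\<in>f ` {1..<v}. u < f v)" for v and f :: "nat \<Rightarrow> nat"
    by auto
  have *: "(\<forall>w\<in>{1..<v}. p w < p v) \<longleftrightarrow> (\<forall>w\<in>{1..<v}. q w < q v) \<and> v \<noteq> m + 1" for v
  proof -
    consider "v < m" | "v = m" | "v = m + 1" | "m + 2 \<le> v"
      by linarith
    then show ?thesis
    proof cases
      case 1
      then have "q w = w" "p w = w" if "w \<le> v" for w
        using that q[of w] below[of w] by auto
      then show ?thesis using 1 by auto
    next
      case 2
      have "q w < q v" "p w < p v" if "w \<in> {1..<v}" for w
        using that 2 q[of w] qm below[of w] pm by auto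
      then show ?thesis using 2 by auto
    next
      case 3
      then have "m \<in> {1..<v}" "\<not> p m < p v"
        using m pm by auto
      then show ?thesis using 3 by blast
    next
      case 4
      then have "q v = p v"
        using q by simp
      from 4 have "v \<noteq> m + 1"
        by simp
      have "(\<forall>u\<in>p ` {1..<v}. u < p v) \<longleftrightarrow> (\<forall>u\<in>q ` {1..<v}. u < q v)"
        unfolding img[OF 4] \<open>q v = p v\<close> ..
      then have "(\<forall>w\<in>{1..<v}. p w < p v) \<longleftrightarrow> (\<forall>w\<in>{1..<v}. q w < q v)"
        by (subst (asm) (1 2) lr[symmetric])
      then show ?thesis
        using \<open>v \<noteq> m + 1\<close> by (rule_tac trans) simp_all
    qed
  qed
  show "lr_max n p = lr_max n q - {m + 1}"
    unfolding lr_max_def * by blast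
  have e: "p v < v \<longleftrightarrow> v = m + 1 \<or> q v < v" for v
  proof -
    consider "v = m" | "v = m + 1" | "v \<noteq> m" "v \<noteq> m + 1"
      by blast
    then show ?thesis
    proof cases
      case 1
      then show ?thesis using qm pm by simp
    next
      case 2
      then show ?thesis using m by simp
    next
      case 3
      then show ?thesis by (simp add: q)
    qed
  qed
  show "anti_exc n p = insert (m + 1) (anti_exc n q)"
    unfolding anti_exc_def e using m by auto
qed

section \<open>Signed sums over derangements of an interval\<close>

text \<open>
  The permutations fix the points below $m$, which therefore always belong to the left-to-right
  maxima. This is why the sums below are expressed by $\{1..j\}$ and not by $\{m..j\}$.
\<close>

definition derang :: "nat \<Rightarrow> nat \<Rightarrow> nat \<Rightarrow> (nat \<Rightarrow> nat) set" where
  "derang m n j = {p. p permutes {m..n} \<and> (\<forall>i\<in>{m..n}. p i \<noteq> i) \<and> p j = n}"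

text \<open>The function \<open>f\<close> is arbitrary, and not a fixed monomial, because the
  contraction of positions replaces it by another function of the two sets.\<close>

definition signed_weight ::
  "(nat set \<Rightarrow> nat set \<Rightarrow> 'a :: comm_ring_1) \<Rightarrow> nat \<Rightarrow> (nat \<Rightarrow> nat) \<Rightarrow> 'a" where
  "signed_weight f n p = of_int (sign p) * f (lr_max n p) (anti_exc n p)"

lemma finite_derang [simp]: "finite (derang m n j)"
  by (rule finite_subset[OF _ finite_permutations[of "{m..n}"]]) (auto simp: derang_def)

lemma permutes_interval_Suc:
  fixes m n :: nat
  assumes "p permutes {m..n}" "p m = m"
  shows "p permutes {m + 1..n}"
  using assms(2) by (intro permutes_superset[OF assms(1)]) (auto simp: not_le le_less_Suc_eq)

lemma permutes_interval_bounds: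
  fixes m n :: nat
  assumes "p permutes {m..n}"
  shows "i < m \<Longrightarrow> p i = i" "m \<le> i \<Longrightarrow> m \<le> p i" "p i = p k \<longleftrightarrow> i = k"
proof -
  show "p i = i" if "i < m"
    using permutes_not_in[OF assms, of i] that by simp
  show "m \<le> p i" if "m \<le> i"
    using that permutes_in_image[OF assms, of i] permutes_not_in[OF assms, of i]
    by (cases "i \<in> {m..n}") auto
  show "p i = p k \<longleftrightarrow> i = k"
    by (rule inj_eq[OF permutes_inj[OF assms]])
qed

lemma sign_transpose_comp:
  assumes "p permutes {m..n::nat}" "m < n"
  shows "sign (transpose m (m + 1) \<circ> p) = - sign p"
    and "sign (p \<circ> transpose m (m + 1)) = - sign p"
  using permutes_imp_permutation[OF _ assms(1)]
  by (simp_all add: sign_compose sign_swap_id permutation_swap_id)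

lemma transpose_comp_permutes:
  assumes "p permutes {m..n::nat}" "m < n"
  shows "(transpose m (m + 1) \<circ> p) permutes {m..n}"
    and "(p \<circ> transpose m (m + 1)) permutes {m..n}"
  using assms by (auto intro!: permutes_compose permutes_swap_id)

lemma transpose_comp_twice:
  "transpose a b \<circ> (transpose a b \<circ> p) = p" "(p \<circ> transpose a b) \<circ> transpose a b = p"
  by (simp_all add: fun_eq_iff)

section \<open>Cancellation and contraction at the left end of the interval\<close>

text \<open>Both \<open>p m\<close> and \<open>p (m + 1)\<close> are at least \<open>m + 2\<close>,
  so the values \<open>m\<close> and \<open>m + 1\<close> sit at positions beyond
  \<open>m + 1\<close> and exchanging them creates no fixed point. This gives a sign-reversing
  involution that keeps both sets.\<close>

lemma signed_sum_neither_eq_0: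
  assumes "1 \<le> m" "m + 2 \<le> n"
  shows "(\<Sum>p\<in>{p \<in> derang m n j. p m \<noteq> m + 1 \<and> p (m + 1) \<noteq> m}. signed_weight f n p) = 0"
    (is "sum _ ?G = 0")
proof -
  define t where "t = transpose m (m + 1)"
  have big: "m + 2 \<le> p m" "m + 2 \<le> p (m + 1)" if "p \<in> ?G" for p
  proof -
    have p: "p permutes {m..n}" "p m \<noteq> m" "p (m + 1) \<noteq> m + 1" "p m \<noteq> m + 1" "p (m + 1) \<noteq> m"
      using that assms by (auto simp: derang_def)
    moreover have "m \<le> p m" "m \<le> p (m + 1)"
      using permutes_interval_bounds(2)[OF p(1)] by auto
    ultimately show "m + 2 \<le> p m" "m + 2 \<le> p (m + 1)"
      by linarith+
  qed
  have tG: "t \<circ> p \<in> ?G" and L: "lr_max n (t \<circ> p) = lr_max n p"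
    and A: "anti_exc n (t \<circ> p) = anti_exc n p" and sg: "sign (t \<circ> p) = - sign p" if "p \<in> ?G" for p
  proof -
    have p: "p permutes {m..n}" "\<forall>i\<in>{m..n}. p i \<noteq> i" "p j = n"
      using that by (auto simp: derang_def)
    note b = big[OF that]
    have "t (p i) \<noteq> i" if "i \<in> {m..n}" for i
    proof (cases "i = m \<or> i = m + 1")
      case True
      then show ?thesis using b by (auto simp: t_def transpose_def)
    next
      case False
      then show ?thesis using p(2) that by (auto simp: t_def transpose_def)
    qed
    moreover have "t (p j) = n"
      using p(3) assms by (simp add: t_def transpose_def)
    moreover have "t (p m) = p m" "t (p (m + 1)) = p (m + 1)"
      using b by (auto simp: t_def transpose_def)
    ultimately show "t \<circ> p \<in> ?G"
      using transpose_comp_permutes(1)[OF p(1)] assms b by (simp add: derang_def t_def)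
    show "lr_max n (t \<circ> p) = lr_max n p" "anti_exc n (t \<circ> p) = anti_exc n p"
      unfolding t_def using transpose_values_lr_max_anti_exc[OF p(1)] assms b p(2) by auto
    show "sign (t \<circ> p) = - sign p"
      unfolding t_def using sign_transpose_comp(1)[OF p(1)] assms by simp
  qed
  let ?f = "\<lambda>p. f (lr_max n p) (anti_exc n p)"
  \<comment> \<open>The two sign classes are matched with each other. Showing that the sum equals
    its own negative would not suffice in a ring where 2 is a zero divisor.\<close>
  have "sum ?f {p \<in> ?G. sign p = 1} = sum ?f {p \<in> ?G. sign p = - 1}"
  proof (rule sum.reindex_bij_witness[of _ "\<lambda>p. t \<circ> p" "\<lambda>p. t \<circ> p"])
    fix p assume "p \<in> {p \<in> ?G. sign p = 1}"
    then have p: "p \<in> ?G" "sign p = 1" by blast+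
    show "t \<circ> (t \<circ> p) = p"
      by (simp add: t_def transpose_comp_twice)
    show "t \<circ> p \<in> {p \<in> ?G. sign p = - 1}"
      using tG[OF p(1)] sg[OF p(1)] p(2) by simp
    show "?f (t \<circ> p) = ?f p"
      by (simp only: L[OF p(1)] A[OF p(1)])
  next
    fix p assume "p \<in> {p \<in> ?G. sign p = - 1}"
    then have p: "p \<in> ?G" "sign p = - 1" by blast+
    show "t \<circ> (t \<circ> p) = p"
      by (simp add: t_def transpose_comp_twice)
    show "t \<circ> p \<in> {p \<in> ?G. sign p = 1}"
      using tG[OF p(1)] sg[OF p(1)] p(2) by simp
  qed
  moreover have "sum (signed_weight f n) ?G
      = sum (signed_weight f n) {p \<in> ?G. sign p = 1} + sum (signed_weight f n) {p \<in> ?G. sign p = - 1}"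
  proof (subst sum.union_disjoint[symmetric])
    have "?G = {p \<in> ?G. sign p = 1 \<or> sign p = - 1}"
      by (auto simp: sign_def)
    also have "\<dots> = {p \<in> ?G. sign p = 1} \<union> {p \<in> ?G. sign p = - 1}"
      by blast
    finally show "sum (signed_weight f n) ?G
        = sum (signed_weight f n) ({p \<in> ?G. sign p = 1} \<union> {p \<in> ?G. sign p = - 1})"
      by (rule arg_cong)
  qed auto
  moreover have "sum (signed_weight f n) {p \<in> ?G. sign p = 1} = sum ?f {p \<in> ?G. sign p = 1}"
    by (intro sum.cong refl) (simp add: signed_weight_def)
  moreover have "sum (signed_weight f n) {p \<in> ?G. sign p = - 1} = - sum ?f {p \<in> ?G. sign p = - 1}"
    unfolding sum_negf[symmetric] by (intro sum.cong refl) (simp add: signed_weight_def)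
  ultimately show ?thesis
    by simp
qed

text \<open>Exchanging the values makes \<open>m\<close> a fixed point, and
  \<open>p (m + 1) \<noteq> m\<close> is what keeps \<open>m + 1\<close> from becoming one. It also
  gives \<open>p (m + 1) \<ge> m + 2\<close>, so both sets survive the exchange and only the sign
  changes.\<close>

lemma signed_sum_contract_values:
  assumes "1 \<le> m" "m + 2 \<le> n"
  shows "(\<Sum>p\<in>{p \<in> derang m n j. p m = m + 1 \<and> p (m + 1) \<noteq> m}. signed_weight f n p)
       = - sum (signed_weight f n) (derang (m + 1) n j)" (is "sum _ ?B = _")
proof -
  define t where "t = transpose m (m + 1)"
  have t: "t m = m + 1" "t (m + 1) = m" "t (Suc m) = m" "t n = n"
    using assms by (auto simp: t_def)
  have t': "t x = x" if "x \<noteq> m" "x \<noteq> m + 1" for x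
    using that by (simp add: t_def transpose_def)
  have tt: "t \<circ> (t \<circ> p) = p" for p :: "nat \<Rightarrow> nat"
    by (simp add: t_def transpose_comp_twice)
  have t_inj: "t x = t y \<longleftrightarrow> x = y" for x y
    by (auto simp: t_def transpose_def)
  have "sum (signed_weight f n) ?B = (\<Sum>p\<in>derang (m + 1) n j. - signed_weight f n p)"
  proof (rule sum.reindex_bij_witness[of _ "\<lambda>p. t \<circ> p" "\<lambda>p. t \<circ> p"])
    fix p assume "p \<in> ?B"
    then have p: "p permutes {m..n}" "\<forall>i\<in>{m..n}. p i \<noteq> i" "p j = n" "p m = m + 1" "p (m + 1) \<noteq> m"
      by (auto simp: derang_def)
    show "t \<circ> (t \<circ> p) = p"
      by (rule tt)
    have "(t \<circ> p) permutes {m + 1..n}"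
      using transpose_comp_permutes(1)[OF p(1)] assms p(4) t
      by (intro permutes_interval_Suc) (auto simp: t_def)
    moreover have "t (p i) \<noteq> i" if "i \<in> {m + 1..n}" for i
    proof (cases "i = m + 1")
      case True
      then show ?thesis using t_inj[of "p (m + 1)" m] p(5) t by simp
    next
      case False
      then have "t i = i" "p i \<noteq> i"
        using that p(2) t' by auto
      then show ?thesis using t_inj[of "p i" i] by simp
    qed
    ultimately show "t \<circ> p \<in> derang (m + 1) n j"
      using t p(3) by (simp add: derang_def)
    have "p (m + 1) \<noteq> p m" "m + 1 \<le> n" "m \<le> p (m + 1)"
      using permutes_interval_bounds(2,3)[OF p(1)] assms by auto
    then have "m + 2 \<le> p (m + 1)"
      using p(4,5) by linarith
    then show "- signed_weight f n (t \<circ> p) = signed_weight f n p"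
      using transpose_values_lr_max_anti_exc[OF p(1)] sign_transpose_comp(1)[OF p(1)] assms p(4)
      by (simp add: signed_weight_def t_def)
  next
    fix p assume "p \<in> derang (m + 1) n j"
    then have p: "p permutes {m + 1..n}" "\<forall>i\<in>{m + 1..n}. p i \<noteq> i" "p j = n"
      by (auto simp: derang_def)
    show "t \<circ> (t \<circ> p) = p"
      by (rule tt)
    have "p permutes {m..n}"
      by (rule permutes_subset[OF p(1)]) auto
    then have "(t \<circ> p) permutes {m..n}"
      using transpose_comp_permutes(1) assms by (auto simp: t_def)
    moreover have pm: "p m = m"
      using permutes_interval_bounds(1)[OF p(1), of m] by simp
    moreover have "p (m + 1) \<noteq> m + 1"
      using p(2) assms by auto
    moreover have "t (p i) \<noteq> i" if "i \<in> {m..n}" for i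
    proof (cases "i = m \<or> i = m + 1")
      case True
      moreover have "p (m + 1) \<noteq> m"
        using permutes_interval_bounds(2)[OF p(1), of "m + 1"] by simp
      ultimately show ?thesis
        using t_inj[of "p (m + 1)" m] t pm by auto
    next
      case False
      then have "t i = i" "p i \<noteq> i"
        using that p(2) t' by auto
      then show ?thesis using t_inj[of "p i" i] by simp
    qed
    moreover have "t (p (m + 1)) \<noteq> m"
      using t_inj[of "p (m + 1)" "m + 1"] t p(2) assms by auto
    ultimately show "t \<circ> p \<in> ?B"
      using t p(3) by (simp add: derang_def)
  qed
  then show ?thesis
    by (simp add: sum_negf)
qed

text \<open>Exchanging the positions makes \<open>m\<close> fixed, and also \<open>m + 1\<close>
  exactly when \<open>p m = m + 1\<close>. The value \<open>n\<close> travels along, from position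
  \<open>m\<close> to \<open>m + 1\<close> if \<open>j = m\<close>. The change of the two sets is
  absorbed into \<open>g\<close>. For \<open>j = m + 1\<close> the left-hand sums are empty, whereas
  \<open>derang (m + 1) n (m + 1)\<close> is not, so that case is excluded.\<close>

lemma signed_sum_contract_positions:
  fixes f :: "nat set \<Rightarrow> nat set \<Rightarrow> 'a :: comm_ring_1"
  assumes m: "1 \<le> m" "m + 2 \<le> n" and j: "m \<le> j" "j \<noteq> m + 1"
  defines "g \<equiv> (\<lambda>L A. f (L - {m + 1}) (insert (m + 1) A))"
  shows "(\<Sum>p\<in>{p \<in> derang m n j. p m \<noteq> m + 1 \<and> p (m + 1) = m}. signed_weight f n p)
       = - sum (signed_weight g n) (derang (m + 1) n (if j = m then m + 1 else j))"
      (is "sum _ ?A = - sum _ (derang _ _ ?j)")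
    and "(\<Sum>p\<in>{p \<in> derang m n j. p m = m + 1 \<and> p (m + 1) = m}. signed_weight f n p)
       = - sum (signed_weight g n) (derang (m + 2) n j)" (is "sum _ ?C = _")
proof -
  define t where "t = transpose m (m + 1)"
  have t: "t m = m + 1" "t (m + 1) = m" "t (Suc m) = m"
    by (auto simp: t_def)
  have t': "t x = x" if "x \<noteq> m" "x \<noteq> m + 1" for x
    using that by (simp add: t_def transpose_def)
  have tt: "(p \<circ> t) \<circ> t = p" for p :: "nat \<Rightarrow> nat"
    by (simp add: t_def transpose_comp_twice)
  have tj: "t ?j = j"
    using t t'[of j] j by auto
  have tj': "t j = ?j"
    using t t'[of j] j by auto
  have weight: "- signed_weight g n (p \<circ> t) = signed_weight f n p"
    if "p permutes {m..n}" "p (m + 1) = m" for p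
  proof -
    have "m < n"
      using m by simp
    then show ?thesis
      unfolding signed_weight_def g_def t_def sign_transpose_comp(2)[OF that(1) \<open>m < n\<close>]
        transpose_positions_lr_max_anti_exc(1)[OF that(1) m(1) \<open>m < n\<close> that(2), symmetric]
        transpose_positions_lr_max_anti_exc(2)[OF that(1) m(1) \<open>m < n\<close> that(2), symmetric]
      by simp
  qed
  have "sum (signed_weight f n) ?A = (\<Sum>p\<in>derang (m + 1) n ?j. - signed_weight g n p)"
  proof (rule sum.reindex_bij_witness[of _ "\<lambda>p. p \<circ> t" "\<lambda>p. p \<circ> t"])
    fix p assume "p \<in> ?A"
    then have p: "p permutes {m..n}" "\<forall>i\<in>{m..n}. p i \<noteq> i" "p j = n" "p m \<noteq> m + 1" "p (m + 1) = m"
      by (auto simp: derang_def)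
    show "(p \<circ> t) \<circ> t = p"
      by (rule tt)
    have "(p \<circ> t) permutes {m + 1..n}"
      using transpose_comp_permutes(2)[OF p(1)] m p(5) t
      by (intro permutes_interval_Suc) (auto simp: t_def)
    moreover have "p (t i) \<noteq> i" if "i \<in> {m + 1..n}" for i
    proof (cases "i = m + 1")
      case True
      then show ?thesis using p(4) t by simp
    next
      case False
      then show ?thesis using that p(2) t'[of i] by simp
    qed
    ultimately show "p \<circ> t \<in> derang (m + 1) n ?j"
      using tj p(3) by (simp add: derang_def)
    show "- signed_weight g n (p \<circ> t) = signed_weight f n p"
      using p by (intro weight)
  next
    fix p assume "p \<in> derang (m + 1) n ?j"
    then have p: "p permutes {m + 1..n}" "\<forall>i\<in>{m + 1..n}. p i \<noteq> i" "p ?j = n"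
      by (auto simp: derang_def)
    show "(p \<circ> t) \<circ> t = p"
      by (rule tt)
    have "p permutes {m..n}"
      by (rule permutes_subset[OF p(1)]) auto
    then have "(p \<circ> t) permutes {m..n}"
      using transpose_comp_permutes(2) m by (auto simp: t_def)
    moreover have pm: "p m = m"
      using permutes_interval_bounds(1)[OF p(1), of m] by simp
    moreover have pm1: "p (m + 1) \<noteq> m + 1" "p (m + 1) \<noteq> m"
      using p(2) permutes_interval_bounds(2)[OF p(1), of "m + 1"] m by auto
    moreover have "p (t i) \<noteq> i" if "i \<in> {m..n}" for i
    proof (cases "i = m \<or> i = m + 1")
      case True
      then show ?thesis using pm pm1 t by auto
    next
      case False
      then show ?thesis using that p(2) t'[of i] by simp
    qed
    ultimately show "p \<circ> t \<in> ?A"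
      using t tj' p(3) by (simp add: derang_def)
  qed
  then show "sum (signed_weight f n) ?A = - sum (signed_weight g n) (derang (m + 1) n ?j)"
    by (simp add: sum_negf)
  have "sum (signed_weight f n) ?C = (\<Sum>p\<in>derang (m + 2) n j. - signed_weight g n p)"
  proof (rule sum.reindex_bij_witness[of _ "\<lambda>p. p \<circ> t" "\<lambda>p. p \<circ> t"])
    fix p assume "p \<in> ?C"
    then have p: "p permutes {m..n}" "\<forall>i\<in>{m..n}. p i \<noteq> i" "p j = n" "p m = m + 1" "p (m + 1) = m"
      by (auto simp: derang_def)
    show "(p \<circ> t) \<circ> t = p"
      by (rule tt)
    have "(p \<circ> t) permutes {m + 1..n}"
      using transpose_comp_permutes(2)[OF p(1)] m p(5) t
      by (intro permutes_interval_Suc) (auto simp: t_def)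
    \<comment> \<open>Here \<open>p \<circ> t\<close> sends \<open>m + 1\<close> to
      \<open>p m = m + 1\<close>, so a second point drops out of the interval.\<close>
    then have "(p \<circ> t) permutes {m + 1 + 1..n}"
      using p(4) t by (rule_tac permutes_interval_Suc) auto
    moreover have "p (t i) \<noteq> i" if "i \<in> {m + 2..n}" for i
      using that p(2) t'[of i] by auto
    moreover have "p (t j) = n"
      using p(3,4) tj' m by auto
    ultimately show "p \<circ> t \<in> derang (m + 2) n j"
      by (simp add: derang_def)
    show "- signed_weight g n (p \<circ> t) = signed_weight f n p"
      using p by (intro weight)
  next
    fix p assume "p \<in> derang (m + 2) n j"
    then have p: "p permutes {m + 2..n}" "\<forall>i\<in>{m + 2..n}. p i \<noteq> i" "p j = n"
      by (auto simp: derang_def)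
    show "(p \<circ> t) \<circ> t = p"
      by (rule tt)
    have "p permutes {m..n}"
      by (rule permutes_subset[OF p(1)]) auto
    then have "(p \<circ> t) permutes {m..n}"
      using transpose_comp_permutes(2) m by (auto simp: t_def)
    moreover have pm: "p m = m" "p (m + 1) = m + 1"
      using permutes_interval_bounds(1)[OF p(1)] by simp_all
    moreover have "p (t i) \<noteq> i" if "i \<in> {m..n}" for i
    proof (cases "i = m \<or> i = m + 1")
      case True
      then show ?thesis using pm t by auto
    next
      case False
      then show ?thesis using that p(2) t'[of i] by simp
    qed
    moreover have "j \<noteq> m"
      using pm p(3) m by auto
    ultimately show "p \<circ> t \<in> ?C"
      using t tj' p(3) by (simp add: derang_def)
  qed
  then show "sum (signed_weight f n) ?C = - sum (signed_weight g n) (derang (m + 2) n j)"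
    by (simp add: sum_negf)
qed

section \<open>Evaluation of the signed sum by induction\<close>

text \<open>For \<open>j = m\<close> this removes the contribution of the value contraction, since
  the shorter interval no longer contains \<open>j\<close>.\<close>

lemma derang_empty:
  assumes "j < m" "j \<noteq> n"
  shows "derang m n j = {}"
proof -
  have "p j = j" if "p permutes {m..n}" for p
    using permutes_interval_bounds(1)[OF that] assms by simp
  then show ?thesis
    using assms(2) unfolding derang_def by force
qed

lemma derang_two: "derang m (m + 1) m = {transpose m (m + 1)}"
proof -
  have "{m..m + 1} = {m, m + 1}"
    by auto
  then show ?thesis
    by (auto simp: derang_def permutes_doubleton_iff)
qed

lemma lr_max_anti_exc_transpose:
  assumes "1 \<le> m"
  shows "lr_max (m + 1) (transpose m (m + 1)) = {1..m}"
    and "anti_exc (m + 1) (transpose m (m + 1)) = {m + 1}"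
proof -
  let ?t = "transpose m (m + 1)"
  have "v \<in> lr_max (m + 1) ?t \<longleftrightarrow> v \<in> {1..m}" for v
  proof (cases "v = m + 1")
    case True
    then have "m \<in> {1..<v}" "\<not> ?t m < ?t v"
      using assms by auto
    then show ?thesis
      using True unfolding lr_max_def by fastforce
  next
    case False
    then have "?t w < ?t v" if "w < v" "v \<le> m + 1" for w
      using that by (auto simp: transpose_def)
    then show ?thesis
      using False by (auto simp: lr_max_def)
  qed
  then show "lr_max (m + 1) ?t = {1..m}"
    by blast
  show "anti_exc (m + 1) ?t = {m + 1}"
    using assms by (auto simp: anti_exc_def transpose_def split: if_splits)
qed

text \<open>For \<open>j = m\<close> only the class \<open>A\<close> contributes, for
  \<open>j = m + 1\<close> only \<open>B\<close>. For larger \<open>j\<close> the classes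
  \<open>A\<close> and \<open>C\<close> cancel, because their intervals differ in length by one and
  the same \<open>g\<close> is evaluated at the same sets; again \<open>B\<close> remains.\<close>

lemma signed_sum_derang:
  fixes f :: "nat set \<Rightarrow> nat set \<Rightarrow> 'a :: comm_ring_1"
  assumes "1 \<le> m" "m \<le> j" "j < n"
  shows "sum (signed_weight f n) (derang m n j) = (- 1) ^ (n - m) * f {1..j} {j + 1..n}"
  using assms
\<comment> \<open>Strong induction, as the class \<open>C\<close> shortens the interval by two. The
  function varies because it becomes \<open>g\<close>, and \<open>j\<close> varies because
  \<open>j = m\<close> is moved to \<open>m + 1\<close>.\<close>
proof (induction "n - m" arbitrary: m j f rule: less_induct)
  case less
  show ?case
  proof (cases "n = m + 1")
    case True
    then have "j = m"
      using less.prems by simp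
    have "sum (signed_weight f (m + 1)) (derang m (m + 1) m) = - f {1..m} {m + 1}"
      unfolding derang_two signed_weight_def using lr_max_anti_exc_transpose[OF less.prems(1)]
      by (simp add: sign_swap_id)
    then show ?thesis
      unfolding \<open>j = m\<close> True by simp
  next
    case False
    then have mn: "m + 2 \<le> n"
      using less.prems by simp
    define W where "W = signed_weight f n"
    define G where "G = {p \<in> derang m n j. p m \<noteq> m + 1 \<and> p (m + 1) \<noteq> m}"
    define B where "B = {p \<in> derang m n j. p m = m + 1 \<and> p (m + 1) \<noteq> m}"
    define A where "A = {p \<in> derang m n j. p m \<noteq> m + 1 \<and> p (m + 1) = m}"
    define C where "C = {p \<in> derang m n j. p m = m + 1 \<and> p (m + 1) = m}"
    define g where "g = (\<lambda>L A. f (L - {m + 1}) (insert (m + 1) A))"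
    have fin: "finite G" "finite B" "finite A" "finite C"
      by (simp_all add: G_def B_def A_def C_def)
    have "derang m n j = (G \<union> B) \<union> (A \<union> C)"
      by (auto simp: G_def B_def A_def C_def)
    then have "sum W (derang m n j) = sum W ((G \<union> B) \<union> (A \<union> C))"
      by simp
    also have "\<dots> = sum W (G \<union> B) + sum W (A \<union> C)"
      using fin by (intro sum.union_disjoint) (auto simp: G_def B_def A_def C_def)
    also have "sum W (G \<union> B) = sum W G + sum W B"
      using fin by (intro sum.union_disjoint) (auto simp: G_def B_def)
    also have "sum W (A \<union> C) = sum W A + sum W C"
      using fin by (intro sum.union_disjoint) (auto simp: A_def C_def)
    also have "sum W G = 0"
      unfolding W_def G_def using less.prems mn by (intro signed_sum_neither_eq_0) auto
    also have "sum W B = - sum W (derang (m + 1) n j)"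
      unfolding W_def B_def using less.prems mn by (intro signed_sum_contract_values) auto
    finally have split: "sum W (derang m n j) = - sum W (derang (m + 1) n j) + (sum W A + sum W C)"
      by simp
    have IH1: "sum (signed_weight h n) (derang (m + 1) n k)
        = (- 1) ^ (n - (m + 1)) * h {1..k} {k + 1..n}" if "m + 1 \<le> k" "k < n"
      for h :: "nat set \<Rightarrow> nat set \<Rightarrow> 'a" and k
      using that mn less.prems(1) by (intro less.hyps) auto
    have power1: "(- 1 :: 'a) ^ (n - m) = - ((- 1) ^ (n - (m + 1)))"
    proof -
      have "n - m = Suc (n - (m + 1))"
        using mn by simp
      then show ?thesis by simp
    qed
    consider "j = m" | "j = m + 1" | "m + 2 \<le> j"
      using less.prems by linarith
    then have "sum W (derang m n j) = (- 1) ^ (n - m) * f {1..j} {j + 1..n}"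
    proof cases
      case 1
      have "sum W A = - sum (signed_weight g n) (derang (m + 1) n (m + 1))"
        using signed_sum_contract_positions(1)[of m n j f] 1 less.prems mn by (simp add: W_def A_def g_def)
      also have "sum (signed_weight g n) (derang (m + 1) n (m + 1))
          = (- 1) ^ (n - (m + 1)) * g {1..m + 1} {m + 2..n}"
        using IH1[of "m + 1" g] mn by simp
      \<comment> \<open>The hypothesis for \<open>m + 1\<close> places \<open>m + 1\<close> among
        the maxima; \<open>g\<close> moves it over to the anti-excedances.\<close>
      also have "g {1..m + 1} {m + 2..n} = f {1..m} {m + 1..n}"
      proof -
        have "{1..m + 1} - {m + 1} = {1..m}" "insert (m + 1) {m + 2..n} = {m + 1..n}"
          using mn by auto
        then show ?thesis
          unfolding g_def by (simp only:)
      qed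
      finally have "sum W A = (- 1) ^ (n - m) * f {1..m} {m + 1..n}"
        unfolding power1 by simp
      moreover have "C = {}"
        using 1 mn by (auto simp: C_def derang_def)
      moreover have "derang (m + 1) n j = {}"
        using 1 mn by (intro derang_empty) auto
      ultimately show ?thesis
        using split 1 by simp
    next
      case 2
      \<comment> \<open>Position \<open>m + 1\<close> holds \<open>n\<close>, hence not
        \<open>m\<close>.\<close>
      then have "A = {}" "C = {}"
        using mn by (auto simp: A_def C_def derang_def)
      moreover have "sum W (derang (m + 1) n j) = (- 1) ^ (n - (m + 1)) * f {1..j} {j + 1..n}"
        unfolding W_def using 2 mn by (intro IH1) auto
      ultimately show ?thesis
        using split unfolding power1 by simp
    next
      case 3
      have "sum W A = - sum (signed_weight g n) (derang (m + 1) n j)"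
        using signed_sum_contract_positions(1)[of m n j f] 3 less.prems mn by (simp add: W_def A_def g_def)
      also have "\<dots> = - ((- 1) ^ (n - (m + 1)) * g {1..j} {j + 1..n})"
        using IH1[of j g] 3 less.prems by simp
      finally have "sum W A = - ((- 1) ^ (n - (m + 1)) * g {1..j} {j + 1..n})" .
      moreover have "sum W C = - sum (signed_weight g n) (derang (m + 2) n j)"
        using signed_sum_contract_positions(2)[of m n j f] 3 less.prems mn by (simp add: W_def C_def g_def)
      moreover have "sum (signed_weight g n) (derang (m + 2) n j)
          = (- 1) ^ (n - (m + 2)) * g {1..j} {j + 1..n}"
        using 3 less.prems by (intro less.hyps) auto
      moreover have "(- 1 :: 'a) ^ (n - (m + 1)) = - ((- 1) ^ (n - (m + 2)))"
      proof -
        have "n - (m + 1) = Suc (n - (m + 2))"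
          using mn by simp
        then show ?thesis by simp
      qed
      moreover have "sum W (derang (m + 1) n j) = (- 1) ^ (n - (m + 1)) * f {1..j} {j + 1..n}"
        unfolding W_def using 3 less.prems by (intro IH1) auto
      ultimately show ?thesis
        using split unfolding power1 by simp
    qed
    then show ?thesis
      by (simp add: W_def)
  qed
qed

section \<open>Passage to the inverse permutation\<close>

lemma minus_one_power_cyc:
  assumes "\<sigma> permutes {1..n}"
  shows "(- 1 :: 'a :: comm_ring_1) ^ cyc n \<sigma> = (- 1) ^ n * of_int (sign \<sigma>)"
proof -
  have "(- 1 :: int) ^ cyc n \<sigma> = (- 1) ^ n * sign \<sigma>"
    unfolding cyc_def using card_orbits_parity[OF _ assms] by simp
  then have "of_int ((- 1) ^ cyc n \<sigma>) = (of_int ((- 1) ^ n * sign \<sigma>) :: 'a)"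
    by (rule arg_cong)
  then show ?thesis
    by simp
qed

lemma derang_1: "derang 1 n j = {p \<in> derangements n. p j = n}"
  by (auto simp: derang_def derangements_def)

lemma derangements_inv:
  assumes "\<sigma> \<in> derangements n"
  shows "inv \<sigma> \<in> derangements n"
  using assms permutes_inv permutes_inv_eq unfolding derangements_def by fastforce

lemma EXCv_eq_anti_exc:
  assumes \<sigma>: "\<sigma> permutes {1..n}"
  shows "EXCv n \<sigma> = anti_exc n (inv \<sigma>)"
proof (rule set_eqI)
  fix v
  have "v \<in> EXCv n \<sigma> \<longleftrightarrow> inv \<sigma> v \<in> EXCi n \<sigma>"
    unfolding EXCv_def using permutes_inverses[OF \<sigma>] by (metis image_iff)
  also have "\<dots> \<longleftrightarrow> v \<in> anti_exc n (inv \<sigma>)"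
    using permutes_in_image[OF permutes_inv[OF \<sigma>], of v] permutes_inverses[OF \<sigma>]
    by (auto simp: EXCi_def anti_exc_def)
  finally show "v \<in> EXCv n \<sigma> \<longleftrightarrow> v \<in> anti_exc n (inv \<sigma>)" .
qed

text \<open>Substituting \<open>k = inv \<sigma> w\<close> expresses the condition through
  \<open>inv \<sigma>\<close> alone. By injectivity its contrapositive says that all smaller indices
  have smaller images under \<open>inv \<sigma>\<close>.\<close>

lemma RLMv_eq_lr_max:
  assumes \<sigma>: "\<sigma> permutes {1..n}"
  shows "RLMv n \<sigma> = lr_max n (inv \<sigma>)"
proof (rule set_eqI)
  fix v
  note inverses = permutes_inverses[OF \<sigma>]
  have "v \<in> RLMv n \<sigma> \<longleftrightarrow> inv \<sigma> v \<in> RLMi n \<sigma>"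
    unfolding RLMv_def using inverses by (metis image_iff)
  also have "\<dots> \<longleftrightarrow> v \<in> {1..n} \<and> (\<forall>k\<in>{1..n}. inv \<sigma> v < k \<longrightarrow> v < \<sigma> k)"
    using permutes_in_image[OF permutes_inv[OF \<sigma>], of v] inverses by (auto simp: RLMi_def)
  also have "\<dots> \<longleftrightarrow> v \<in> {1..n} \<and> (\<forall>w\<in>{1..n}. inv \<sigma> v < inv \<sigma> w \<longrightarrow> v < w)"
  proof -
    have "(\<forall>k\<in>{1..n}. Q k) \<longleftrightarrow> (\<forall>w\<in>{1..n}. Q (inv \<sigma> w))" for Q
      using permutes_image[OF permutes_inv[OF \<sigma>]] by (metis imageE image_eqI)
    from this[of "\<lambda>k. inv \<sigma> v < k \<longrightarrow> v < \<sigma> k"] show ?thesis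
      using inverses by simp
  qed
  also have "\<dots> \<longleftrightarrow> v \<in> lr_max n (inv \<sigma>)"
  proof -
    have "inv \<sigma> v = inv \<sigma> w \<longleftrightarrow> v = w" for w
      by (rule inj_eq[OF permutes_inj[OF permutes_inv[OF \<sigma>]]])
    then have "(inv \<sigma> v < inv \<sigma> w \<longrightarrow> v < w) \<longleftrightarrow> (w < v \<longrightarrow> inv \<sigma> w < inv \<sigma> v)" for w
      by (metis linorder_neqE_nat not_less_iff_gr_or_eq)
    then show ?thesis
      by (auto simp: lr_max_def)
  qed
  finally show "v \<in> RLMv n \<sigma> \<longleftrightarrow> v \<in> lr_max n (inv \<sigma>)" .
qed

section \<open>Symmetry under reversal of positions and values\<close>

text \<open>Extended by the identity outside the interval, so that it is an involution on all
  natural numbers and a permutation of \<open>{1..n}\<close>.\<close>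

definition reflect :: "nat \<Rightarrow> nat \<Rightarrow> nat" where
  "reflect n i = (if i \<in> {1..n} then n + 1 - i else i)"

lemma reflect_reflect [simp]: "reflect n (reflect n i) = i"
  by (auto simp: reflect_def)

lemma reflect_mem_iff [simp]: "reflect n i \<in> {1..n} \<longleftrightarrow> i \<in> {1..n}"
  by (auto simp: reflect_def)

lemma reflect_less_iff: "i \<in> {1..n} \<Longrightarrow> k \<in> {1..n} \<Longrightarrow> reflect n i < reflect n k \<longleftrightarrow> k < i"
  by (auto simp: reflect_def)

lemma mem_image_reflect_iff: "i \<in> reflect n ` S \<longleftrightarrow> reflect n i \<in> S"
  by (metis image_iff reflect_reflect)

lemma reflect_permutes: "reflect n permutes {1..n}"
  by (intro bij_imp_permutes bij_betwI[of _ _ _ "reflect n"]) (auto simp: reflect_def)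

text \<open>The reverse-complement of \<open>\<sigma>\<close>, that is, the permutation matrix
  rotated by 180 degrees. Being a conjugate, it has the same sign and also stays free of fixed
  points.\<close>

definition conj_reflect :: "nat \<Rightarrow> (nat \<Rightarrow> nat) \<Rightarrow> nat \<Rightarrow> nat" where
  "conj_reflect n \<sigma> = reflect n \<circ> \<sigma> \<circ> reflect n"

lemma conj_reflect_twice: "conj_reflect n (conj_reflect n \<sigma>) = \<sigma>"
  by (simp add: conj_reflect_def fun_eq_iff)

lemma conj_reflect_permutes: "\<sigma> permutes {1..n} \<Longrightarrow> conj_reflect n \<sigma> permutes {1..n}"
  unfolding conj_reflect_def by (intro permutes_compose reflect_permutes)

lemma sign_conj_reflect:
  assumes "\<sigma> permutes {1..n}"
  shows "sign (conj_reflect n \<sigma>) = sign \<sigma>"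
proof -
  have "permutation \<sigma>" "permutation (reflect n)"
    using assms reflect_permutes by (auto intro: permutes_imp_permutation)
  then show ?thesis
    by (simp add: conj_reflect_def sign_compose permutation_compose)
qed

lemma derangements_conj_reflect:
  assumes "\<sigma> \<in> derangements n"
  shows "conj_reflect n \<sigma> \<in> derangements n"
proof -
  have \<sigma>: "\<sigma> permutes {1..n}" "\<forall>i\<in>{1..n}. \<sigma> i \<noteq> i"
    using assms by (auto simp: derangements_def)
  have "conj_reflect n \<sigma> i \<noteq> i" if "i \<in> {1..n}" for i
  proof -
    have "\<sigma> (reflect n i) \<noteq> reflect n i"
      using \<sigma>(2) that reflect_mem_iff by blast
    then show ?thesis
      unfolding conj_reflect_def by (metis comp_apply reflect_reflect)
  qed
  then show ?thesis
    using conj_reflect_permutes[OF \<sigma>(1)] by (simp add: derangements_def)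
qed

lemma EXCi_eq_reflect_anti_exc:
  assumes \<sigma>: "\<sigma> permutes {1..n}"
  shows "EXCi n \<sigma> = reflect n ` anti_exc n (conj_reflect n \<sigma>)"
proof (rule set_eqI)
  fix i
  have "\<sigma> i \<in> {1..n} \<longleftrightarrow> i \<in> {1..n}"
    by (rule permutes_in_image[OF \<sigma>])
  then show "i \<in> EXCi n \<sigma> \<longleftrightarrow> i \<in> reflect n ` anti_exc n (conj_reflect n \<sigma>)"
    unfolding mem_image_reflect_iff EXCi_def anti_exc_def conj_reflect_def
    using reflect_less_iff[of "\<sigma> i" n i] reflect_mem_iff[of n i] by auto
qed

text \<open>The order is reversed on positions and on values at once: larger values at later
  positions become smaller values at earlier positions.\<close>

lemma RLMi_eq_reflect_lr_max:
  assumes \<sigma>: "\<sigma> permutes {1..n}"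
  shows "RLMi n \<sigma> = reflect n ` lr_max n (conj_reflect n \<sigma>)"
proof (rule set_eqI)
  fix i
  let ?r = "reflect n"
  have in_image: "\<sigma> k \<in> {1..n} \<longleftrightarrow> k \<in> {1..n}" for k
    by (rule permutes_in_image[OF \<sigma>])
  have "(\<forall>w\<in>{1..<?r i}. ?r (\<sigma> (?r w)) < ?r (\<sigma> i)) \<longleftrightarrow> (\<forall>k\<in>{1..n}. i < k \<longrightarrow> \<sigma> i < \<sigma> k)"
    if i: "i \<in> {1..n}"
  proof
    assume *: "\<forall>w\<in>{1..<?r i}. ?r (\<sigma> (?r w)) < ?r (\<sigma> i)"
    show "\<forall>k\<in>{1..n}. i < k \<longrightarrow> \<sigma> i < \<sigma> k"
    proof (intro ballI impI)
      fix k assume k: "k \<in> {1..n}" "i < k"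
      then have "?r k \<in> {1..<?r i}"
        using reflect_less_iff[OF k(1) i] reflect_mem_iff[of n k] by simp
      from bspec[OF * this] show "\<sigma> i < \<sigma> k"
        using reflect_less_iff[of "\<sigma> k" n "\<sigma> i"] in_image i k by simp
    qed
  next
    assume *: "\<forall>k\<in>{1..n}. i < k \<longrightarrow> \<sigma> i < \<sigma> k"
    show "\<forall>w\<in>{1..<?r i}. ?r (\<sigma> (?r w)) < ?r (\<sigma> i)"
    proof
      fix w assume w: "w \<in> {1..<?r i}"
      then have w': "w \<in> {1..n}"
        using i by (auto simp: reflect_def)
      then have rw: "?r w \<in> {1..n}"
        using reflect_mem_iff by blast
      then have "i < ?r w"
        using reflect_less_iff[of "?r w" n i] i w by simp
      then have "\<sigma> i < \<sigma> (?r w)"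
        using * rw by blast
      then show "?r (\<sigma> (?r w)) < ?r (\<sigma> i)"
        using reflect_less_iff[of "\<sigma> (?r w)" n "\<sigma> i"] in_image i rw by blast
    qed
  qed
  then show "i \<in> RLMi n \<sigma> \<longleftrightarrow> i \<in> ?r ` lr_max n (conj_reflect n \<sigma>)"
    unfolding mem_image_reflect_iff RLMi_def lr_max_def conj_reflect_def
    using reflect_mem_iff[of n i] by auto
qed

section \<open>The two identities\<close>

text \<open>The factor \<open>(- 1) ^ n\<close> converts the sign of a permutation into the parity
  of its cycle count. Together with \<open>(- 1) ^ (n - 1)\<close> from the induction it leaves a
  single minus sign.\<close>

lemma signed_sum_derang_1:
  fixes f :: "nat set \<Rightarrow> nat set \<Rightarrow> 'a :: comm_ring_1"
  assumes "n \<ge> 2" "j \<in> {1..n - 1}"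
  shows "(\<Sum>p\<in>derang 1 n j. (- 1) ^ n * signed_weight f n p) = - f {1..j} {j + 1..n}"
proof -
  obtain k where k: "n = Suc k"
    using assms by (cases n) auto
  have "sum (signed_weight f n) (derang 1 n j) = (- 1) ^ k * f {1..j} {j + 1..n}"
    using signed_sum_derang[of 1 j n f] assms k by auto
  then have "(- 1) ^ n * sum (signed_weight f n) (derang 1 n j)
      = - (((- 1) ^ k * (- 1) ^ k) * f {1..j} {j + 1..n})"
    using k by simp
  then show ?thesis
    by (simp add: sum_distrib_left flip: power_mult_distrib)
qed

theorem theorem1p1:
  fixes n j :: nat
  assumes "n \<ge> 2" and "j \<in> {1..n - 1}"
  shows "(\<Sum>\<sigma>\<in>derangements_last n j.
            (- 1) ^ cyc n \<sigma> * (\<Prod>i\<in>RLMv n \<sigma>. x_var i) * (\<Prod>i\<in>EXCv n \<sigma>. y_var i))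
          = - ((\<Prod>i\<in>{1..j}. x_var i) * (\<Prod>i\<in>{j + 1..n}. y_var i))
       \<and> (\<Sum>\<sigma>\<in>derangements_one n j.
            (- 1) ^ cyc n \<sigma> * (\<Prod>i\<in>RLMi n \<sigma>. x_var i) * (\<Prod>i\<in>EXCi n \<sigma>. y_var i))
          = - ((\<Prod>i\<in>{1..n - j}. y_var i) * (\<Prod>i\<in>{n + 1 - j..n}. x_var i))"
    (is "?S1 = _ \<and> ?S2 = _")
proof
  let ?f = "\<lambda>L A. (\<Prod>i\<in>L. x_var i) * (\<Prod>i\<in>A. y_var i)"
  have "?S1 = (\<Sum>p\<in>derang 1 n j. (- 1) ^ n * signed_weight ?f n p)"
  proof (rule sum.reindex_bij_witness[of _ inv inv])
    fix \<sigma> assume "\<sigma> \<in> derangements_last n j"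
    then have \<sigma>: "\<sigma> \<in> derangements n" "\<sigma> n = j"
      by (auto simp: derangements_last_def)
    then have p: "\<sigma> permutes {1..n}"
      by (simp add: derangements_def)
    show "inv (inv \<sigma>) = \<sigma>"
      by (rule permutes_inv_inv[OF p])
    show "inv \<sigma> \<in> derang 1 n j"
      unfolding derang_1 using derangements_inv[OF \<sigma>(1)] permutes_inverses(2)[OF p, of n] \<sigma>(2) by simp
    have "sign (inv \<sigma>) = sign \<sigma>"
      using p by (intro sign_inverse) (auto intro: permutes_imp_permutation)
    then show "(- 1) ^ n * signed_weight ?f n (inv \<sigma>)
        = (- 1) ^ cyc n \<sigma> * (\<Prod>i\<in>RLMv n \<sigma>. x_var i) * (\<Prod>i\<in>EXCv n \<sigma>. y_var i)"
      by (simp add: signed_weight_def minus_one_power_cyc[OF p] EXCv_eq_anti_exc[OF p]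
          RLMv_eq_lr_max[OF p] mult.assoc)
  next
    fix p assume "p \<in> derang 1 n j"
    then have p: "p \<in> derangements n" "p j = n"
      unfolding derang_1 by simp_all
    then have p': "p permutes {1..n}"
      by (simp add: derangements_def)
    show "inv (inv p) = p"
      by (rule permutes_inv_inv[OF p'])
    show "inv p \<in> derangements_last n j"
      unfolding derangements_last_def
      using derangements_inv[OF p(1)] permutes_inverses(2)[OF p', of j] p(2) by simp
  qed
  then show "?S1 = - ((\<Prod>i\<in>{1..j}. x_var i) * (\<Prod>i\<in>{j + 1..n}. y_var i))"
    by (simp only: signed_sum_derang_1[OF assms])
  \<comment> \<open>Under \<open>conj_reflect n\<close> the sets \<open>RLMi\<close> and
    \<open>EXCi\<close> are the reflected images of \<open>lr_max\<close> and
    \<open>anti_exc\<close>, so the reflection is built into the weight.\<close>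
  let ?g = "\<lambda>L A. ?f (reflect n ` L) (reflect n ` A)"
  have j: "n + 1 - j \<in> {1..n}" "j \<in> {1..n}" "reflect n j = n + 1 - j" "reflect n (n + 1 - j) = j"
    "reflect n 1 = n" "reflect n n = 1"
    using assms by (auto simp: reflect_def)
  have "?S2 = (\<Sum>p\<in>derang 1 n j. (- 1) ^ n * signed_weight ?g n p)"
  proof (rule sum.reindex_bij_witness[of _ "conj_reflect n" "conj_reflect n"])
    fix \<sigma> assume "\<sigma> \<in> derangements_one n j"
    then have \<sigma>: "\<sigma> \<in> derangements n" "\<sigma> (n + 1 - j) = 1"
      by (auto simp: derangements_one_def)
    then have p: "\<sigma> permutes {1..n}"
      by (simp add: derangements_def)
    show "conj_reflect n (conj_reflect n \<sigma>) = \<sigma>"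
      by (rule conj_reflect_twice)
    \<comment> \<open>The reflection takes \<open>j\<close> to \<open>n + 1 - j\<close>, then
      \<open>\<sigma>\<close> gives 1, which is reflected to \<open>n\<close>.\<close>
    have "conj_reflect n \<sigma> j = n"
      unfolding conj_reflect_def comp_apply j \<sigma> ..
    then show "conj_reflect n \<sigma> \<in> derang 1 n j"
      unfolding derang_1 using derangements_conj_reflect[OF \<sigma>(1)] by simp
    show "(- 1) ^ n * signed_weight ?g n (conj_reflect n \<sigma>)
        = (- 1) ^ cyc n \<sigma> * (\<Prod>i\<in>RLMi n \<sigma>. x_var i) * (\<Prod>i\<in>EXCi n \<sigma>. y_var i)"
      by (simp add: signed_weight_def minus_one_power_cyc[OF p] EXCi_eq_reflect_anti_exc[OF p]
          RLMi_eq_reflect_lr_max[OF p] sign_conj_reflect[OF p] mult.assoc)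
  next
    fix p assume "p \<in> derang 1 n j"
    then have p: "p \<in> derangements n" "p j = n"
      unfolding derang_1 by simp_all
    show "conj_reflect n (conj_reflect n p) = p"
      by (rule conj_reflect_twice)
    have "conj_reflect n p (n + 1 - j) = 1"
      unfolding conj_reflect_def comp_apply j p ..
    then show "conj_reflect n p \<in> derangements_one n j"
      unfolding derangements_one_def using derangements_conj_reflect[OF p(1)] by simp
  qed
  moreover have "reflect n ` {1..j} = {n + 1 - j..n}"
    unfolding set_eq_iff mem_image_reflect_iff using assms by (auto simp: reflect_def)
  moreover have "reflect n ` {j + 1..n} = {1..n - j}"
    unfolding set_eq_iff mem_image_reflect_iff using assms by (auto simp: reflect_def)
  \<comment> \<open>Commutativity is used because the second identity lists the \<open>y\<close>
    factors first.\<close>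
  ultimately show "?S2 = - ((\<Prod>i\<in>{1..n - j}. y_var i) * (\<Prod>i\<in>{n + 1 - j..n}. x_var i))"
    by (simp only: signed_sum_derang_1[OF assms] mult.commute)
qed

end
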